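(* Let $R$ be a dedekind type domain, let $\mathit{M}(R)$ be the monoid generated by the maximal ideals of $R$, let $\mathcal{I}\in\mathit{M}(R)$, and let $k\ge2$. Let $\mathcal{F}$ be a finite set of maximal ideals containing every maximal ideal that contains $\mathcal{I}$, and let $\Sigma:\mathit{M}(\mathcal{F})\to R$ be a nowhere zero map satisfying conditions (1)–(4) below. Then every element of $\mathbb{PF}^k_{\mathcal{I}}$ can be written as $[\Sigma(\mathcal{J}_0)v_0:\Sigma(\mathcal{J}_1)v_1:\dots:\Sigma(\mathcal{J}_k)v_k]$ where $\mathcal{J}_0,\dots,\mathcal{J}_k\in\mathit{M}(\mathcal{F})$ with $\mathcal{J}_i\supseteq\mathcal{I}$ and $\sum_i\mathcal{J}_i=R$ (hence $\sum_i(\Sigma(\mathcal{J}_i))=R$), and $v_0,\dots,v_k\in R\setminus\bigcup_{\mathcal{M}\in\mathcal{F}}\mathcal{M}$ with $\sum_{i=0}^k(\Sigma(\mathcal{J}_i)v_i)=R$; that is, $\mathbb{PF}^k_{\mathcal{I}}$ equals the set of all such classes.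
   Context: Dedekind type domain: a commutative ring $R$ with unity which is a field, or in which every maximal ideal $\mathcal{M}$ satisfies $\mathcal{M}^i\neq\mathcal{M}^{i+1}$ ($i\ge0$), $\bigcap_{i\ge0}\mathcal{M}^i=(0)$, $\dim_{R/\mathcal{M}}\mathcal{M}^i/\mathcal{M}^{i+1}=1$ ($i\ge0$), and every nonzero element lies in only finitely many maximal ideals. $\mathit{M}(\mathcal{F})$ ($\mathit{M}(R)$) is the set of finite products of maximal ideals in $\mathcal{F}$ (resp. all maximal ideals), $R$ being the empty product; $\mathit{M}(\mathcal{F})^*=\mathit{M}(\mathcal{F})\setminus\{R\}$; $\mathcal{S}_{\mathcal{J}}=\mathcal{J}\setminus\bigcup_{\mathcal{K}\in\mathit{M}(\mathcal{F})^*}\mathcal{J}\mathcal{K}$. Conditions on $\Sigma$: (1) $\Sigma(R)=1$; (2) $\Sigma(\mathcal{J})\in\mathcal{S}_{\mathcal{J}}$; (3) $\Sigma(\mathcal{J}\mathcal{K})=\Sigma(\mathcal{J})\Sigma(\mathcal{K})$ for comaximal $\mathcal{J},\mathcal{K}$; (4) $\sum\mathcal{J}_i=R\Rightarrow\sum(\Sigma(\mathcal{J}_i))=R$ (such $\Sigma$ exists). Projective space: for an ideal $\mathcal{I}\in\mathit{M}(R)$, unital tuples $(a_0,\dots,a_k)$ (i.e. $(a_0,\dots,a_k)=R$) are identified when $a_ib_j-a_jb_i\in\mathcal{I}$ for all $i<j$; $[a_0:\dots:a_k]$ is the class and $\mathbb{PF}^k_{\mathcal{I}}$ the set of classes. 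*)

theory Defs
  imports "HOL-Algebra.Algebra" "Jordan_Normal_Form.Missing_VectorSpace"
begin

abbreviation ideal_pow :: "('a, 'b) ring_scheme \<Rightarrow> 'a set \<Rightarrow> nat \<Rightarrow> 'a set"
  where "ideal_pow R M i \<equiv> M [^]\<^bsub>ideals_set R\<^esub> i"

abbreviation ideal_sum :: "('a, 'b) ring_scheme \<Rightarrow> ('i \<Rightarrow> 'a set) \<Rightarrow> 'i set \<Rightarrow> 'a set"
  where "ideal_sum R J A \<equiv> finsum (ideals_set R) J A"

text \<open>The quotient \<open>M^i / M^(i+1)\<close> as a module over \<open>R / M\<close>.  The scalar product of the cosets of
  \<open>a\<close> and \<open>x\<close> is the coset of \<open>a x\<close>; the fields \<open>mult\<close> and \<open>one\<close> are only there because the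
  module record extends the ring record, and play no role.\<close>

definition ideal_layer :: "('a, 'b) ring_scheme \<Rightarrow> 'a set \<Rightarrow> nat \<Rightarrow> ('a set, 'a set) module"
  where "ideal_layer R M i = (let N = ideal_pow R M (Suc i) in
    \<lparr> carrier = (\<lambda>x. N +>\<^bsub>R\<^esub> x) ` ideal_pow R M i,
      monoid.mult = rcoset_mult R N,
      one = N +>\<^bsub>R\<^esub> \<one>\<^bsub>R\<^esub>,
      ring.zero = N,
      ring.add = set_add R,
      smult = rcoset_mult R N \<rparr>)"

lemma ideal_pow_ideal:
  assumes "cring R" "ideal M R" shows "ideal (ideal_pow R M i) R"
proof -
  interpret cring R by fact
  interpret S: comm_monoid "ideals_set R" by (rule ideals_set_is_comm_monoid)
  have "M \<in> carrier (ideals_set R)" using assms by (simp add: ideals_set_def)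
  then have "ideal_pow R M i \<in> carrier (ideals_set R)" by simp
  then show ?thesis by (simp add: ideals_set_def)
qed

lemma ideal_pow_Suc: "ideal_pow R M (Suc i) = ideal_pow R M i \<cdot>\<^bsub>R\<^esub> M"
  by (simp add: nat_pow_def ideals_set_def)

lemma vectorspace_ideal_layer:
  fixes R :: "('a, 'b) ring_scheme" (structure)
  assumes "cring R" "maximalideal M R"
  shows "vectorspace (R Quot M) (ideal_layer R M i)"
proof -
  interpret cring R by fact
  interpret M: maximalideal M R by fact
  define P where "P = ideal_pow R M i"
  define N where "N = ideal_pow R M (Suc i)"
  have P: "ideal P R" unfolding P_def using assms ideal_pow_ideal M.ideal_axioms by blast
  have N: "ideal N R" unfolding N_def using assms ideal_pow_ideal M.ideal_axioms by blast
  interpret P: ideal P R by fact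
  interpret N: ideal N R by fact
  have NPM: "N = P \<cdot> M" unfolding N_def P_def by (rule ideal_pow_Suc)
  have NP: "N \<subseteq> P" using NPM ideal_prod_inter[OF P M.ideal_axioms] by blast
  have fld: "field (R Quot M)" using M.quotient_is_field assms by blast
  have L: "ideal_layer R M i = \<lparr> carrier = (\<lambda>x. N +> x) ` P,
      monoid.mult = rcoset_mult R N, one = N +> \<one>, ring.zero = N, ring.add = set_add R,
      smult = rcoset_mult R N \<rparr>"
    by (simp add: ideal_layer_def N_def P_def Let_def)
  have eq: "N +> x = N +> y" if "x \<in> carrier R" "y \<in> carrier R" "x \<ominus> y \<in> N" for x y
    using that quotient_eq_iff_same_a_r_cos[OF N] by blast
  have inN: "m \<otimes> p \<in> N" if "m \<in> M" "p \<in> P" for m p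
    using that ideal_prod.prod[of p P m M R] NPM m_comm P.a_Hcarr M.a_Hcarr by metis
  have sm: "[mod N:] (M +> a) \<Otimes> (N +> x) = N +> (a \<otimes> x)"
    if a: "a \<in> carrier R" and x: "x \<in> P" for a x
  proof -
    have xc: "x \<in> carrier R" using x by (rule P.a_Hcarr)
    have *: "N +> (b \<otimes> y) = N +> (a \<otimes> x)" if b: "b \<in> M +> a" and y: "y \<in> N +> x" for b y
    proof -
      obtain m where m: "m \<in> M" "b = m \<oplus> a" using b by (auto simp: a_r_coset_def')
      obtain n where n: "n \<in> N" "y = n \<oplus> x" using y by (auto simp: a_r_coset_def')
      have mc: "m \<in> carrier R" and nc: "n \<in> carrier R" using m n M.a_Hcarr N.a_Hcarr by auto
      have "(b \<otimes> y) \<ominus> (a \<otimes> x) = (m \<oplus> a) \<otimes> n \<oplus> m \<otimes> x"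
        unfolding m n using mc nc a xc
        by algebra
      moreover have "(m \<oplus> a) \<otimes> n \<oplus> m \<otimes> x \<in> N"
        using n(1) inN[OF m(1) x] a mc by (simp add: N.I_l_closed N.a_closed)
      ultimately show ?thesis using eq a xc mc nc m n by simp
    qed
    have "a \<in> M +> a" "x \<in> N +> x" using M.a_rcos_self a N.a_rcos_self xc by auto
    then show ?thesis unfolding rcoset_mult_def using * by blast
  qed
  have cr: "carrier (R Quot M) = (\<lambda>a. M +> a) ` carrier R"
    by (auto simp: FactRing_def A_RCOSETS_def')
  have ab: "abelian_group (ideal_layer R M i)"
  proof (rule abelian_groupI, goal_cases)
    case (1 x y) then show ?case unfolding L by (auto simp: N.a_rcos_sum P.a_closed)
  next case 2
    have "N = N +> \<zero>" using N.a_rcos_const[OF N.zero_closed] by simp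
    then show ?case unfolding L using P.zero_closed by auto
  next case (3 x y z) then show ?case unfolding L
      by (auto simp: N.a_rcos_sum P.a_closed a_assoc)
  next case (4 x y) then show ?case unfolding L
      by (auto simp: N.a_rcos_sum P.a_closed a_comm)
  next case (5 x) then show ?case unfolding L
      using N.a_rcos_sum[of \<zero>] N.a_rcos_const[of \<zero>] N.zero_closed by auto
  next case (6 x) then obtain p where p: "p \<in> P" "x = N +> p" unfolding L by auto
    then have "N +> (\<ominus> p) \<in> carrier (ideal_layer R M i)" unfolding L by auto
    moreover have "(N +> (\<ominus> p)) <+> x = N"
      using p N.a_rcos_sum[of "\<ominus> p" p] P.a_Hcarr[OF p(1)] l_neg N.a_rcos_const[of \<zero>] N.zero_closed by auto
    moreover have "ring.add (ideal_layer R M i) = set_add R" "ring.zero (ideal_layer R M i) = N" by (simp_all add: L)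
    ultimately show ?case by metis
  qed
  have Lsm: "(M +> a) \<odot>\<^bsub>ideal_layer R M i\<^esub> (N +> x) = N +> (a \<otimes> x)" if "a \<in> carrier R" "x \<in> P" for a x
    using sm that by (simp add: L)
  have Lc: "carrier (ideal_layer R M i) = (\<lambda>x. N +> x) ` P"
    and La: "ring.add (ideal_layer R M i) = set_add R" by (simp_all add: L)
  have Qs: "ring.add (R Quot M) = set_add R" "monoid.mult (R Quot M) = rcoset_mult R M" "\<one>\<^bsub>R Quot M\<^esub> = M +> \<one>"
    by (simp_all add: FactRing_def)
  have "module (R Quot M) (ideal_layer R M i)"
  proof (rule moduleI)
    show "cring (R Quot M)" using fld by (simp add: field_def domain_def)
    show "abelian_group (ideal_layer R M i)" by fact
  qed (auto simp: cr Lc La Qs Lsm M.a_rcos_sum N.a_rcos_sum M.rcoset_mult_add P.I_l_closed P.a_closed l_distr r_distr m_assoc)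
  with fld show ?thesis by (simp add: vectorspace_def)
qed

text \<open>In \<^const>\<open>vectorspace.dim\<close> the dimension is a least natural number, which is unspecified for
  spaces of infinite dimension; hence the conjunct \<^const>\<open>vectorspace.fin_dim\<close>.\<close>

definition dedekind_type_domain :: "('a, 'b) ring_scheme \<Rightarrow> bool"
  where "dedekind_type_domain R \<longleftrightarrow> cring R \<and>
    (field R \<or>
      (\<forall>M. maximalideal M R \<longrightarrow>
        (\<forall>i. ideal_pow R M i \<noteq> ideal_pow R M (Suc i)) \<and>
        (\<Inter>i. ideal_pow R M i) = {\<zero>\<^bsub>R\<^esub>} \<and>
        (\<forall>i. vectorspace.fin_dim (R Quot M) (ideal_layer R M i) \<and>
             vectorspace.dim (R Quot M) (ideal_layer R M i) = 1)) \<and>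
      (\<forall>a \<in> carrier R - {\<zero>\<^bsub>R\<^esub>}. finite {M. maximalideal M R \<and> a \<in> M}))"

definition maximal_ideals :: "('a, 'b) ring_scheme \<Rightarrow> 'a set set"
  where "maximal_ideals R = {M. maximalideal M R}"

inductive_set ideal_monoid :: "('a, 'b) ring_scheme \<Rightarrow> 'a set set \<Rightarrow> 'a set set"
  for R and F
  where
    unit: "carrier R \<in> ideal_monoid R F"
  | mult: "\<lbrakk> M \<in> F; J \<in> ideal_monoid R F \<rbrakk> \<Longrightarrow> M \<cdot>\<^bsub>R\<^esub> J \<in> ideal_monoid R F"

definition exact_elements :: "('a, 'b) ring_scheme \<Rightarrow> 'a set set \<Rightarrow> 'a set \<Rightarrow> 'a set"
  where "exact_elements R F J = J - (\<Union>K \<in> ideal_monoid R F - {carrier R}. J \<cdot>\<^bsub>R\<^esub> K)"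

definition choice_conditions :: "('a, 'b) ring_scheme \<Rightarrow> 'a set set \<Rightarrow> ('a set \<Rightarrow> 'a) \<Rightarrow> bool"
  where "choice_conditions R F \<Sigma> \<longleftrightarrow>
    \<Sigma> (carrier R) = \<one>\<^bsub>R\<^esub> \<and>
    (\<forall>J \<in> ideal_monoid R F. \<Sigma> J \<in> exact_elements R F J) \<and>
    (\<forall>J \<in> ideal_monoid R F. \<forall>K \<in> ideal_monoid R F.
      J <+>\<^bsub>R\<^esub> K = carrier R \<longrightarrow> \<Sigma> (J \<cdot>\<^bsub>R\<^esub> K) = \<Sigma> J \<otimes>\<^bsub>R\<^esub> \<Sigma> K) \<and>
    (\<forall>(n::nat) J. J \<in> {..n} \<rightarrow> ideal_monoid R F \<longrightarrow>
      ideal_sum R J {..n} = carrier R \<longrightarrow>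
      ideal_sum R (\<lambda>i. PIdl\<^bsub>R\<^esub> (\<Sigma> (J i))) {..n} = carrier R)"

definition unital_tuples :: "('a, 'b) ring_scheme \<Rightarrow> nat \<Rightarrow> (nat \<Rightarrow> 'a) set"
  where "unital_tuples R k = {a \<in> {..k} \<rightarrow>\<^sub>E carrier R. Idl\<^bsub>R\<^esub> (a ` {..k}) = carrier R}"

definition proj_rel :: "('a, 'b) ring_scheme \<Rightarrow> 'a set \<Rightarrow> nat \<Rightarrow> ((nat \<Rightarrow> 'a) \<times> (nat \<Rightarrow> 'a)) set"
  where "proj_rel R I k = {(a, b). a \<in> unital_tuples R k \<and> b \<in> unital_tuples R k \<and>
    (\<forall>i j. i < j \<and> j \<le> k \<longrightarrow> (a i \<otimes>\<^bsub>R\<^esub> b j) \<ominus>\<^bsub>R\<^esub> (a j \<otimes>\<^bsub>R\<^esub> b i) \<in> I)}"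

definition proj_class :: "('a, 'b) ring_scheme \<Rightarrow> 'a set \<Rightarrow> nat \<Rightarrow> (nat \<Rightarrow> 'a) \<Rightarrow> (nat \<Rightarrow> 'a) set"
  where "proj_class R I k a = proj_rel R I k `` {a}"

definition proj_space :: "('a, 'b) ring_scheme \<Rightarrow> 'a set \<Rightarrow> nat \<Rightarrow> (nat \<Rightarrow> 'a) set set"
  where "proj_space R I k = unital_tuples R k // proj_rel R I k"

end

(* Each J_i is the "gcd" of I and (a_i): its exponent at M in F is the M-adic valuation of a_i,
   truncated at the exponent of I.  Since M^i / M^(i+1) is one-dimensional, an element of exact
   valuation e generates M^e modulo every higher power of M, so a_i is congruent to Sigma(J_i)
   times a unit at M modulo each power of M dividing I, and the Chinese remainder theorem glues
   these units into v_i.  That theorem also lets v_i avoid finitely many further maximal ideals.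
   Choosing v_0 outside the maximal ideals containing Sigma(J_1), and then v_1, ..., v_k outside
   those containing Sigma(J_0) v_0, makes the new tuple unital: a maximal ideal containing all
   Sigma(J_i) v_i would contain all Sigma(J_i). *)

theory Submission
  imports Defs
begin

context cring
begin

section \<open>Maximal ideals as a test for being the whole ring\<close>

lemma exists_maximalideal:
  assumes "ideal I R" "I \<noteq> carrier R"
  shows "\<exists>M. maximalideal M R \<and> I \<subseteq> M"
proof -
  \<comment> \<open>Properness is expressed as \<open>\<one> \<notin> J\<close>, a condition that
    passes to unions of chains, so Zorn's lemma applies.\<close>
  let ?A = "{J. ideal J R \<and> I \<subseteq> J \<and> \<one> \<notin> J}"
  have "\<one> \<notin> I" using assms ideal.one_imp_carrier[of I R] by blast
  then have ne: "?A \<noteq> {}" using assms(1) by blast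
  have "\<exists>M\<in>?A. \<forall>Y\<in>?A. M \<subseteq> Y \<longrightarrow> Y = M"
  proof (rule subset_Zorn_nonempty[OF ne])
    fix C assume C: "C \<noteq> {}" "subset.chain ?A C"
    then have "subset.chain {J. ideal J R} C" by (auto simp: subset_chain_def)
    from chain_Union_is_ideal[OF this] C have "ideal (\<Union>C) R" by simp
    then show "\<Union>C \<in> ?A" using C by (auto simp: subset_chain_def)
  qed
  then obtain M where "M \<in> ?A" and *: "\<forall>Y\<in>?A. M \<subseteq> Y \<longrightarrow> Y = M" by (rule bexE)
  then have M: "ideal M R" "I \<subseteq> M" "\<one> \<notin> M" by simp_all
  have max: "Y = M" if "ideal Y R" "\<one> \<notin> Y" "M \<subseteq> Y" for Y
    using * that M(2) by (simp add: subset_trans[of I M Y])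
  have "maximalideal M R"
  proof (rule maximalidealI[OF M(1)])
    show "carrier R \<noteq> M" using M(3) by blast
    fix J assume "ideal J R" "M \<subseteq> J" "J \<subseteq> carrier R"
    then show "J = M \<or> J = carrier R" using max[of J] ideal.one_imp_carrier[of J R] by blast
  qed
  with M(2) show ?thesis by blast
qed

lemma one_notin_maximalideal: "maximalideal M R \<Longrightarrow> \<one> \<notin> M"
  by (metis ideal.one_imp_carrier maximalideal.I_notcarr maximalideal.axioms(1))

text \<open>A proper ideal lies in some maximal ideal, and a maximal ideal misses
  \<open>\<one>\<close>. The conditions "sum equals R" below, for ideals, principal ideals and
  tuples alike, are all checked through this criterion, one maximal ideal at a time.\<close>

lemma ideal_eq_carrier_iff:
  assumes "ideal I R"
  shows "I = carrier R \<longleftrightarrow> (\<forall>M. maximalideal M R \<longrightarrow> \<not> I \<subseteq> M)"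
  using exists_maximalideal[OF assms] one_notin_maximalideal one_closed by blast

lemma add_ideals_subset_iff:
  assumes I: "ideal I R" and J: "ideal J R" and K: "ideal K R"
  shows "I <+>\<^bsub>R\<^esub> J \<subseteq> K \<longleftrightarrow> I \<subseteq> K \<and> J \<subseteq> K"
proof -
  have "I \<union> J \<subseteq> carrier R" using ideal.Icarr[OF I] ideal.Icarr[OF J] by blast
  from Idl_subset_ideal[OF K this] show ?thesis unfolding union_genideal[OF I J] by simp
qed

text \<open>The universal property of the sum, reduced by induction to two summands. Being an ideal
  is carried along because the two-summand case requires it of the partial sum.\<close>

lemma ideal_sum_subset_iff:
  assumes "finite A" "\<And>i. i \<in> A \<Longrightarrow> ideal (J i) R" and K: "ideal K R"
  shows "ideal (ideal_sum R J A) R \<and> (ideal_sum R J A \<subseteq> K \<longleftrightarrow> (\<forall>i\<in>A. J i \<subseteq> K))"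
  using assms(1,2)
proof (induction A)
  case empty
  interpret S: semiring "ideals_set R" by (rule ideals_set_is_semiring)
  have "ideal_sum R J {} = {\<zero>}" unfolding S.finsum_empty by (simp add: ideals_set_def)
  moreover have "\<zero> \<in> K" by (rule additive_subgroup.zero_closed[OF ideal.axioms(1)[OF K]])
  ultimately show ?case using zeroideal by simp
next
  case (insert i A)
  interpret S: semiring "ideals_set R" by (rule ideals_set_is_semiring)
  have "J \<in> A \<rightarrow> carrier (ideals_set R)" "J i \<in> carrier (ideals_set R)"
    using insert.prems by (auto simp: ideals_set_def)
  then have "ideal_sum R J (insert i A) = J i \<oplus>\<^bsub>ideals_set R\<^esub> ideal_sum R J A"
    by (rule S.finsum_insert[OF insert.hyps])
  also have "\<dots> = J i <+>\<^bsub>R\<^esub> ideal_sum R J A" by (simp add: ideals_set_def)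
  finally have "ideal_sum R J (insert i A) = J i <+>\<^bsub>R\<^esub> ideal_sum R J A" .
  then show ?case using insert K add_ideals add_ideals_subset_iff by auto
qed

lemma ideal_sum_eq_carrier_iff:
  assumes "finite A" "\<And>i. i \<in> A \<Longrightarrow> ideal (J i) R"
  shows "ideal_sum R J A = carrier R \<longleftrightarrow> (\<forall>M. maximalideal M R \<longrightarrow> (\<exists>i\<in>A. \<not> J i \<subseteq> M))"
proof -
  have *: "ideal (ideal_sum R J A) R \<and> (ideal_sum R J A \<subseteq> K \<longleftrightarrow> (\<forall>i\<in>A. J i \<subseteq> K))"
    if "ideal K R" for K by (rule ideal_sum_subset_iff[OF assms that])
  have "ideal (ideal_sum R J A) R" using *[OF oneideal] by (rule conjunct1)
  then have "ideal_sum R J A = carrier R \<longleftrightarrow> (\<forall>M. maximalideal M R \<longrightarrow> \<not> ideal_sum R J A \<subseteq> M)"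
    by (rule ideal_eq_carrier_iff)
  then show ?thesis using *[OF maximalideal.axioms(1)] by meson
qed

lemma principal_ideal_sum_eq_carrier_iff:
  assumes "finite A" "\<And>i. i \<in> A \<Longrightarrow> s i \<in> carrier R"
  shows "ideal_sum R (\<lambda>i. PIdl (s i)) A = carrier R \<longleftrightarrow>
    (\<forall>M. maximalideal M R \<longrightarrow> (\<exists>i\<in>A. s i \<notin> M))"
proof -
  have "PIdl (s i) \<subseteq> M \<longleftrightarrow> s i \<in> M" if "i \<in> A" "maximalideal M R" for i M
    using cgenideal_self[OF assms(2)[OF that(1)]] cgenideal_minimal[OF maximalideal.axioms(1)[OF that(2)]]
    by blast
  moreover have "ideal_sum R (\<lambda>i. PIdl (s i)) A = carrier R \<longleftrightarrow>
      (\<forall>M. maximalideal M R \<longrightarrow> (\<exists>i\<in>A. \<not> PIdl (s i) \<subseteq> M))"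
    by (rule ideal_sum_eq_carrier_iff[OF assms(1) cgenideal_ideal[OF assms(2)]])
  ultimately show ?thesis by meson
qed

lemma genideal_eq_carrier_iff:
  assumes "S \<subseteq> carrier R"
  shows "Idl S = carrier R \<longleftrightarrow> (\<forall>M. maximalideal M R \<longrightarrow> \<not> S \<subseteq> M)"
  using ideal_eq_carrier_iff[OF genideal_ideal[OF assms]]
    Idl_subset_ideal[OF maximalideal.axioms(1) assms] by meson

lemma maximalideal_subset_imp_eq:
  assumes "maximalideal M R" "maximalideal N R" "M \<subseteq> N"
  shows "M = N"
  by (metis assms ideal.Icarr maximalideal.I_maximal maximalideal.I_notcarr maximalideal.axioms(1) subsetI)

section \<open>The monoid generated by a set of maximal ideals\<close>

lemma ideal_maximal_ideals: "F \<subseteq> maximal_ideals R \<Longrightarrow> M \<in> F \<Longrightarrow> ideal M R"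
  using maximalideal.axioms(1) by (auto simp: maximal_ideals_def)

lemma ideal_ideal_monoid:
  assumes "F \<subseteq> maximal_ideals R" "J \<in> ideal_monoid R F"
  shows "ideal J R"
  using assms(2)
proof induction
  case unit show ?case by (rule oneideal)
next
  case (mult M J)
  then show ?case using ideal_maximal_ideals[OF assms(1)] ideal_prod_is_ideal by blast
qed

text \<open>A maximal ideal is prime, so if it contains a product it contains one of the factors,
  and maximality makes it equal to that factor.\<close>

lemma ideal_monoid_subset_maximalideal:
  assumes "F \<subseteq> maximal_ideals R" "J \<in> ideal_monoid R F" "maximalideal N R" "J \<subseteq> N"
  shows "N \<in> F"
  using assms(2,4)
proof induction
  case unit then show ?case using assms(3) one_notin_maximalideal by blast
next
  case (mult M J)
  have M: "maximalideal M R" using mult assms(1) by (auto simp: maximal_ideals_def)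
  have "M \<subseteq> N \<or> J \<subseteq> N"
    by (rule primeideal_divides_ideal_prod[OF maximalideal_prime[OF assms(3)]
          maximalideal.axioms(1)[OF M] ideal_ideal_monoid[OF assms(1) mult.hyps(2)] mult.prems])
  then show ?case using mult maximalideal_subset_imp_eq[OF M assms(3)] by blast
qed

text \<open>A maximal ideal containing the sum contains both \<open>J\<close> and \<open>K\<close>,
  hence would belong to \<open>F\<close> as well as to \<open>G\<close>.\<close>

lemma ideal_monoid_comaximal:
  assumes "F \<subseteq> maximal_ideals R" "G \<subseteq> maximal_ideals R" "F \<inter> G = {}"
    and "J \<in> ideal_monoid R F" "K \<in> ideal_monoid R G"
  shows "J <+>\<^bsub>R\<^esub> K = carrier R"
proof -
  have J: "ideal J R" and K: "ideal K R"
    by (rule ideal_ideal_monoid[OF assms(1,4)], rule ideal_ideal_monoid[OF assms(2,5)])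
  have "\<not> J <+>\<^bsub>R\<^esub> K \<subseteq> M" if M: "maximalideal M R" for M
    using add_ideals_subset_iff[OF J K maximalideal.axioms(1)[OF M]] assms(3)
      ideal_monoid_subset_maximalideal[OF assms(1,4) M] ideal_monoid_subset_maximalideal[OF assms(2,5) M]
    by blast
  then show ?thesis using ideal_eq_carrier_iff[OF add_ideals[OF J K]] by simp
qed

lemma ideal_monoid_mono:
  assumes "F \<subseteq> G" "J \<in> ideal_monoid R F"
  shows "J \<in> ideal_monoid R G"
  using assms(2) by induction (use assms(1) ideal_monoid.intros in blast)+

lemma ideal_monoid_mult:
  assumes "F \<subseteq> maximal_ideals R" "J \<in> ideal_monoid R F" "K \<in> ideal_monoid R F"
  shows "J \<cdot> K \<in> ideal_monoid R F"
  using assms(2)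
proof induction
  case unit
  have K: "ideal K R" by (rule ideal_ideal_monoid[OF assms(1,3)])
  show ?case using assms(3) ideal_prod_one[OF K] ideal_prod_commute[OF K oneideal] by simp
next
  case (mult M J)
  have "ideal M R" "ideal J R" "ideal K R"
    using ideal_maximal_ideals[OF assms(1) mult.hyps(1)] ideal_ideal_monoid[OF assms(1) mult.hyps(2)]
      ideal_ideal_monoid[OF assms(1,3)] by auto
  then have "M \<cdot> J \<cdot> K = M \<cdot> (J \<cdot> K)" by (rule ideal_prod_assoc)
  then show ?case using ideal_monoid.mult[OF mult.hyps(1) mult.IH] by simp
qed

section \<open>Powers of maximal ideals and factorizations by exponents\<close>

lemma ideal_pow_0: "ideal_pow R M 0 = carrier R"
  by (simp add: nat_pow_def ideals_set_def)

lemma ideal_pow_in_ideal_monoid: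
  assumes "M \<in> F" "F \<subseteq> maximal_ideals R"
  shows "ideal_pow R M n \<in> ideal_monoid R F"
proof (induction n)
  case 0 show ?case unfolding ideal_pow_0 by (rule ideal_monoid.unit)
next
  case (Suc n)
  have M: "ideal M R" by (rule ideal_maximal_ideals[OF assms(2,1)])
  have "ideal_pow R M (Suc n) = M \<cdot> ideal_pow R M n"
    unfolding ideal_pow_Suc by (rule ideal_prod_commute[OF ideal_pow_ideal[OF is_cring M] M])
  then show ?case using ideal_monoid.mult[OF assms(1) Suc] by simp
qed

lemma ideal_pow_antimono:
  assumes "ideal M R" "m \<le> n"
  shows "ideal_pow R M n \<subseteq> ideal_pow R M m"
  using assms(2)
proof (rule lift_Suc_antimono_le[rotated])
  fix n
  show "ideal_pow R M (Suc n) \<subseteq> ideal_pow R M n"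
    unfolding ideal_pow_Suc
    using ideal_prod_inter[OF ideal_pow_ideal[OF is_cring assms(1)] assms(1)] by blast
qed

lemma ideal_pow_1:
  assumes "ideal M R" shows "ideal_pow R M (Suc 0) = M"
  unfolding ideal_pow_Suc ideal_pow_0
  using ideal_prod_one[OF assms] ideal_prod_commute[OF assms oneideal] by simp

lemma ideal_pow_Suc_subset: "ideal M R \<Longrightarrow> ideal_pow R M (Suc n) \<subseteq> M"
  using ideal_pow_antimono[of M "Suc 0" "Suc n"] ideal_pow_1 by simp

text \<open>For a finite set of maximal ideals this is the product of the powers
  \<open>M^(e M)\<close>; as an intersection it allows membership to be tested at each
  \<open>M\<close> separately. The condition \<open>x \<in> carrier R\<close> makes the value at
  empty \<open>F\<close> the whole ring.\<close>

definition power_inter :: "'a set set \<Rightarrow> ('a set \<Rightarrow> nat) \<Rightarrow> 'a set"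
  where "power_inter F e = {x \<in> carrier R. \<forall>M\<in>F. x \<in> ideal_pow R M (e M)}"

text \<open>Powers of distinct maximal ideals are comaximal, and comaximal ideals have their
  intersection as product.\<close>

lemma power_inter_in_ideal_monoid:
  assumes "finite F" "F \<subseteq> maximal_ideals R"
  shows "power_inter F e \<in> ideal_monoid R F"
  using assms
proof (induction F)
  case empty
  then show ?case using ideal_monoid.unit by (simp add: power_inter_def)
next
  case (insert M F)
  let ?P = "ideal_pow R M (e M)" and ?Q = "power_inter F e"
  have Q: "?Q \<in> ideal_monoid R F" using insert by auto
  have P: "?P \<in> ideal_monoid R {M}" using insert by (auto intro: ideal_pow_in_ideal_monoid)
  have i: "ideal ?P R" "ideal ?Q R"
    using ideal_ideal_monoid[OF _ P] ideal_ideal_monoid[OF _ Q] insert.prems by auto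
  have "?P <+>\<^bsub>R\<^esub> ?Q = carrier R"
    using P Q insert by (intro ideal_monoid_comaximal[of "{M}" F]) auto
  then have "?P \<cdot> ?Q = ?P \<inter> ?Q" by (rule ideal_prod_eq_inter[OF i])
  also have "\<dots> = power_inter (insert M F) e" by (auto simp: power_inter_def)
  finally show ?case
    using ideal_monoid_mult[OF insert.prems, of ?P ?Q] P Q
      ideal_monoid_mono[of "{M}" "insert M F" ?P] ideal_monoid_mono[of F "insert M F" ?Q] by auto
qed

lemma power_inter_split:
  assumes "finite F" "F \<subseteq> maximal_ideals R" "M \<in> F"
  shows "power_inter F e = ideal_pow R M (e M) \<cdot> power_inter (F - {M}) e"
proof -
  let ?P = "ideal_pow R M (e M)" and ?Q = "power_inter (F - {M}) e"
  have Q: "?Q \<in> ideal_monoid R (F - {M})" using assms by (intro power_inter_in_ideal_monoid) auto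
  have P: "?P \<in> ideal_monoid R {M}" using assms by (auto intro: ideal_pow_in_ideal_monoid)
  have i: "ideal ?P R" "ideal ?Q R"
    using ideal_ideal_monoid[OF _ P] ideal_ideal_monoid[OF _ Q] assms by auto
  have "?P <+>\<^bsub>R\<^esub> ?Q = carrier R"
    using P Q assms by (intro ideal_monoid_comaximal[of "{M}" "F - {M}"]) auto
  then have "?P \<cdot> ?Q = ?P \<inter> ?Q" by (rule ideal_prod_eq_inter[OF i])
  also have "\<dots> = power_inter F e" using assms(3) by (auto simp: power_inter_def)
  finally show ?thesis by simp
qed

text \<open>Splitting off the power at \<open>M\<close> isolates the only exponent that
  changes.\<close>

lemma power_inter_mult:
  assumes "finite F" "F \<subseteq> maximal_ideals R" "M \<in> F"
  shows "M \<cdot> power_inter F e = power_inter F (e(M := Suc (e M)))"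
proof -
  let ?P = "ideal_pow R M (e M)" and ?Q = "power_inter (F - {M}) e"
  have M: "ideal M R" by (rule ideal_maximal_ideals[OF assms(2,3)])
  have P: "ideal ?P R" by (rule ideal_pow_ideal[OF is_cring M])
  have Q: "ideal ?Q R" 
    using power_inter_in_ideal_monoid[of "F - {M}" e] ideal_ideal_monoid[of "F - {M}"] assms by auto
  have "M \<cdot> power_inter F e = (M \<cdot> ?P) \<cdot> ?Q"
    using power_inter_split[OF assms] ideal_prod_assoc[OF M P Q] by simp
  also have "M \<cdot> ?P = ideal_pow R M (Suc (e M))"
    unfolding ideal_pow_Suc by (rule ideal_prod_commute[OF M P])
  also have "?Q = power_inter (F - {M}) (e(M := Suc (e M)))" by (auto simp: power_inter_def)
  finally show ?thesis using power_inter_split[OF assms, of "e(M := Suc (e M))"] by simp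
qed

text \<open>Starting from the exponents zero, each further factor raises one exponent by
  one.\<close>

lemma ideal_monoid_eq_power_inter:
  assumes "finite F" "F \<subseteq> maximal_ideals R" "J \<in> ideal_monoid R F"
  shows "\<exists>e. J = power_inter F e"
  using assms(3)
proof induction
  case unit
  have "carrier R = power_inter F (\<lambda>_. 0)" unfolding power_inter_def ideal_pow_0 by blast
  then show ?case by blast
next
  case (mult M J)
  then show ?case using power_inter_mult[OF assms(1,2)] by blast
qed

text \<open>A product is contained in each of its factors, so the last assumption reaches every
  factor of \<open>J\<close>. This serves to move \<open>I\<close> from the monoid of all maximal
  ideals into that of \<open>F\<close>.\<close>

lemma ideal_monoid_restrict:
  assumes "G \<subseteq> maximal_ideals R" "J \<in> ideal_monoid R G"
    and "\<And>M. M \<in> G \<Longrightarrow> J \<subseteq> M \<Longrightarrow> M \<in> F"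
  shows "J \<in> ideal_monoid R F"
  using assms(2,3)
proof induction
  case unit show ?case by (rule ideal_monoid.unit)
next
  case (mult M J)
  have "ideal M R" "ideal J R"
    using ideal_maximal_ideals[OF assms(1) mult.hyps(1)] ideal_ideal_monoid[OF assms(1) mult.hyps(2)] by auto
  then have "M \<cdot> J \<subseteq> M \<inter> J" by (rule ideal_prod_inter)
  then show ?case using mult by (blast intro: ideal_monoid.mult)
qed

section \<open>The Chinese remainder theorem for powers of maximal ideals\<close>

lemma maximal_power_approximation:
  assumes "finite G" "G \<subseteq> maximal_ideals R" "\<And>M. M \<in> G \<Longrightarrow> t M \<in> carrier R"
  shows "\<exists>v\<in>carrier R. \<forall>M\<in>G. v \<ominus> t M \<in> ideal_pow R M (n M)"
  using assms
proof (induction G)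
  case empty then show ?case by blast
next
  case (insert M G)
  then obtain w where w: "w \<in> carrier R" "\<And>N. N \<in> G \<Longrightarrow> w \<ominus> t N \<in> ideal_pow R N (n N)" by auto
  let ?P = "ideal_pow R M (n M)" and ?Q = "power_inter G n"
  have Q: "?Q \<in> ideal_monoid R G" using insert by (intro power_inter_in_ideal_monoid) auto
  have P: "?P \<in> ideal_monoid R {M}" using insert by (auto intro: ideal_pow_in_ideal_monoid)
  have i: "ideal ?P R" "ideal ?Q R"
    using ideal_ideal_monoid[OF _ P] ideal_ideal_monoid[OF _ Q] insert.prems by auto
  have "?P <+>\<^bsub>R\<^esub> ?Q = carrier R"
    using P Q insert by (intro ideal_monoid_comaximal[of "{M}" G]) auto
  then obtain p q where pq: "p \<in> ?P" "q \<in> ?Q" "\<one> = p \<oplus> q"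
    using one_closed unfolding set_add_def' by blast
  have c: "p \<in> carrier R" "q \<in> carrier R" "t M \<in> carrier R"
    using ideal.Icarr[OF i(1) pq(1)] ideal.Icarr[OF i(2) pq(2)] insert.prems by auto
  \<comment> \<open>Since \<open>q\<close> is congruent to \<open>\<one>\<close> modulo
    \<open>?P\<close> and to \<open>\<zero>\<close> modulo the powers treated before, this
    correction moves \<open>w\<close> to \<open>t M\<close> at \<open>M\<close> and changes nothing
    modulo the other powers.\<close>
  let ?v = "w \<oplus> q \<otimes> (t M \<ominus> w)"
  have "?v \<ominus> t M = (w \<ominus> t M) \<otimes> (p \<oplus> q) \<oplus> q \<otimes> (t M \<ominus> w)"
    using c w(1) pq(3)[symmetric] by (simp, algebra)
  also have "\<dots> = (w \<ominus> t M) \<otimes> p"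
    using c w(1) by algebra
  finally have "?v \<ominus> t M \<in> ?P"
    using pq(1) i(1) c w(1) by (simp add: ideal.I_l_closed)
  moreover have "?v \<ominus> t N \<in> ideal_pow R N (n N)" if N: "N \<in> G" for N
  proof -
    have NI: "ideal (ideal_pow R N (n N)) R"
      using N insert.prems by (intro ideal_pow_ideal[OF is_cring] ideal_maximal_ideals[of "insert M G"]) auto
    have qN: "q \<in> ideal_pow R N (n N)" using pq(2) N by (auto simp: power_inter_def)
    have tN: "t N \<in> carrier R" using N insert.prems by auto
    have "?v \<ominus> t N = (w \<ominus> t N) \<oplus> q \<otimes> (t M \<ominus> w)"
      using c w(1) tN by algebra
    then show ?thesis
      using w(2)[OF N] qN NI c w(1) by (simp add: ideal.I_r_closed additive_subgroup.a_closed ideal.axioms(1))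
  qed
  ultimately show ?case using w(1) c by (intro bexI[of _ ?v]) auto
qed

section \<open>Approximation through the one-dimensional layers\<close>

lemma one_dim_layer:
  assumes M: "maximalideal M R"
    and fd: "vectorspace.fin_dim (R Quot M) (ideal_layer R M i)"
    and dim: "vectorspace.dim (R Quot M) (ideal_layer R M i) = 1"
    and a: "a \<in> ideal_pow R M i" "a \<notin> ideal_pow R M (Suc i)"
    and x: "x \<in> ideal_pow R M i"
  shows "\<exists>r\<in>carrier R. x \<ominus> r \<otimes> a \<in> ideal_pow R M (Suc i)"
proof -
  define V where "V = ideal_layer R M i"
  define N where "N = ideal_pow R M (Suc i)"
  interpret V: vectorspace "R Quot M" V
    unfolding V_def by (rule vectorspace_ideal_layer[OF is_cring M])
  interpret M: maximalideal M R by fact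
  have Pi: "ideal (ideal_pow R M i) R" and Ni: "ideal N R"
    unfolding N_def by (rule ideal_pow_ideal[OF is_cring M.ideal_axioms])+
  interpret N: ideal N R by (rule Ni)
  have ac: "a \<in> carrier R" and xc: "x \<in> carrier R" using ideal.Icarr[OF Pi] a x by auto
  let ?v = "N +> a"
  have Vc: "carrier V = (\<lambda>x. N +> x) ` ideal_pow R M i" and V0: "\<zero>\<^bsub>V\<^esub> = N"
    and Vs: "smult V = rcoset_mult R N"
    by (simp_all add: V_def ideal_layer_def N_def Let_def)
  have v: "?v \<in> carrier V" "?v \<noteq> \<zero>\<^bsub>V\<^esub>"
    using a(1) Vc a(2) V0 N.a_rcos_self[OF ac] unfolding N_def by auto
  \<comment> \<open>The class of \<open>a\<close> is a nonzero vector of a space of dimension one,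
    hence a basis; the required \<open>r\<close> is a lift to \<open>R\<close> of the coordinate of
    \<open>x\<close>.\<close>
  have "V.lin_indpt {?v}"
    using V.lin_dep_iff_in_span[of "{}" ?v] v V.span_empty V.finite_lin_indpt2[of "{}"] by auto
  then have "V.basis {?v}"
    using fd dim v(1) unfolding V_def[symmetric] by (intro V.dim_li_is_basis) auto
  then have "N +> x \<in> V.span {?v}" using Vc x by (auto simp: V.basis_def)
  then obtain f where f: "f \<in> {?v} \<rightarrow> carrier (R Quot M)" "V.lincomb f {?v} = N +> x"
    using V.finite_in_span[of "{?v}"] v(1) by auto
  have "V.lincomb f {?v} = f ?v \<odot>\<^bsub>V\<^esub> ?v"
    using f(1) v(1) by (simp add: V.lincomb_def)
  moreover obtain r where r: "r \<in> carrier R" "f ?v = M +> r"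
    using f(1) by (auto simp: FactRing_def A_RCOSETS_def')
  ultimately have eq: "rcoset_mult R N (M +> r) ?v = N +> x" using f(2) Vs by simp
  \<comment> \<open>It suffices to find one common element: \<open>r \<otimes> a\<close> lies in the
    product of the two cosets, which is \<open>N +> x\<close>, and a coset is determined by any of
    its elements.\<close>
  have "r \<otimes> a \<in> N +> (r \<otimes> a)" using N.a_rcos_self r ac by simp
  then have "r \<otimes> a \<in> N +> x"
    unfolding eq[symmetric] rcoset_mult_def
    using M.a_rcos_self[OF r(1)] N.a_rcos_self[OF ac] by blast
  then have "N +> x = N +> (r \<otimes> a)" by (rule a_repr_independence[OF _ xc N.a_subgroup])
  then have "x \<ominus> r \<otimes> a \<in> N"
    using quotient_eq_iff_same_a_r_cos[OF Ni] xc r(1) ac by simp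
  then show ?thesis using r(1) unfolding N_def by blast
qed

text \<open>For \<open>j \<ge> e\<close> every element of \<open>M^j\<close> is a multiple of
  \<open>a\<close> modulo \<open>M^(j+1)\<close>: layer \<open>e\<close> is the base case, and
  multiplication by \<open>M\<close> carries the property from one layer to the next. Correcting the
  remainder layer by layer then improves the approximation from \<open>M^n\<close> to
  \<open>M^(n+1)\<close>.\<close>

lemma one_dim_layers_generate:
  assumes M: "maximalideal M R"
    and dim: "\<And>i. vectorspace.fin_dim (R Quot M) (ideal_layer R M i) \<and>
             vectorspace.dim (R Quot M) (ideal_layer R M i) = 1"
    and a: "a \<in> ideal_pow R M e" "a \<notin> ideal_pow R M (Suc e)"
    and x: "x \<in> ideal_pow R M e"
  shows "\<exists>r\<in>carrier R. x \<ominus> r \<otimes> a \<in> ideal_pow R M n"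
proof -
  have MI: "ideal M R" by (rule maximalideal.axioms(1)[OF M])
  have PI: "ideal (ideal_pow R M j) R" for j by (rule ideal_pow_ideal[OF is_cring MI])
  have add: "y \<oplus> z \<in> ideal_pow R M j" if "y \<in> ideal_pow R M j" "z \<in> ideal_pow R M j" for y z j
    using additive_subgroup.a_closed[OF ideal.axioms(1)[OF PI] that] .
  have ac: "a \<in> carrier R" and xc: "x \<in> carrier R" using ideal.Icarr[OF PI] a x by auto
  have step: "\<exists>r\<in>carrier R. y \<ominus> r \<otimes> a \<in> ideal_pow R M (Suc j)"
    if "e \<le> j" "y \<in> ideal_pow R M j" for j y
    using that
  proof (induction j arbitrary: y rule: dec_induct)
    case base
    then show ?case using one_dim_layer[OF M _ _ a] dim by blast
  next
    case (step j)
    \<comment> \<open>An element of \<open>M^(j+1)\<close> is a sum of products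
      \<open>p \<otimes> m\<close>. A multiplier \<open>r\<close> for \<open>p\<close> gives
      \<open>r \<otimes> m\<close> for the product, and multipliers of summands add up.\<close>
    from step.prems[unfolded ideal_pow_Suc[of R M j]]
    show ?case
    proof (induction y rule: ideal_prod.induct)
      case (prod p m)
      then obtain r where r: "r \<in> carrier R" "p \<ominus> r \<otimes> a \<in> ideal_pow R M (Suc j)"
        using step.IH by blast
      have c: "p \<in> carrier R" "m \<in> carrier R" using ideal.Icarr[OF PI] ideal.Icarr[OF MI] prod by auto
      have "p \<otimes> m \<ominus> (r \<otimes> m) \<otimes> a = (p \<ominus> r \<otimes> a) \<otimes> m" using c r(1) ac by algebra
      moreover have "(p \<ominus> r \<otimes> a) \<otimes> m \<in> ideal_pow R M (Suc (Suc j))"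
        unfolding ideal_pow_Suc[of R M "Suc j"] by (rule ideal_prod.prod[OF r(2) prod(2)])
      ultimately show ?case using r(1) c by (intro bexI[of _ "r \<otimes> m"]) auto
    next
      case (sum y z)
      then obtain r t where r: "r \<in> carrier R" "y \<ominus> r \<otimes> a \<in> ideal_pow R M (Suc (Suc j))"
        and t: "t \<in> carrier R" "z \<ominus> t \<otimes> a \<in> ideal_pow R M (Suc (Suc j))" by auto
      have c: "y \<in> carrier R" "z \<in> carrier R"
        using sum.hyps[folded ideal_pow_Suc] ideal.Icarr[OF PI] by blast+
      have "y \<oplus> z \<ominus> (r \<oplus> t) \<otimes> a = (y \<ominus> r \<otimes> a) \<oplus> (z \<ominus> t \<otimes> a)" using c r(1) t(1) ac by algebra
      then show ?case using add[OF r(2) t(2)] r(1) t(1) by (intro bexI[of _ "r \<oplus> t"]) auto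
    qed
  qed
  show ?thesis
  proof (induction n)
    case 0
    have "x \<ominus> \<zero> \<otimes> a \<in> ideal_pow R M 0" unfolding ideal_pow_0 using xc ac by simp
    then show ?case using zero_closed by blast
  next
    case (Suc n)
    show ?case
    proof (cases "e \<le> n")
      case True
      obtain r where r: "r \<in> carrier R" "x \<ominus> r \<otimes> a \<in> ideal_pow R M n" using Suc by blast
      obtain t where t: "t \<in> carrier R" "(x \<ominus> r \<otimes> a) \<ominus> t \<otimes> a \<in> ideal_pow R M (Suc n)"
        using step[OF True r(2)] by blast
      have "x \<ominus> (r \<oplus> t) \<otimes> a = (x \<ominus> r \<otimes> a) \<ominus> t \<otimes> a" using xc ac r(1) t(1) by algebra
      then show ?thesis using r(1) t by (intro bexI[of _ "r \<oplus> t"]) auto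
    next
      \<comment> \<open>Below level \<open>e\<close> the element \<open>x\<close> already lies in
        \<open>M^(n+1)\<close>, so the multiplier \<open>\<zero>\<close> does.\<close>
      case False
      then have "x \<in> ideal_pow R M (Suc n)" using ideal_pow_antimono[OF MI, of "Suc n" e] x by auto
      moreover have "x \<ominus> \<zero> \<otimes> a = x" using xc ac by algebra
      ultimately show ?thesis by (intro bexI[of _ "\<zero>"]) auto
    qed
  qed
qed

section \<open>Truncated valuations and multipliers that are units at \<open>F\<close>\<close>

lemma exists_truncated_valuation:
  assumes "a \<in> carrier R"
  shows "\<exists>e\<le>n. a \<in> ideal_pow R M e \<and> (e = n \<or> a \<notin> ideal_pow R M (Suc e))"
proof (induction n)
  case 0
  then show ?case using assms by (intro exI[of _ 0]) (simp add: ideals_set_def)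
next
  case (Suc n)
  then obtain e where "e \<le> n" "a \<in> ideal_pow R M e" "e = n \<or> a \<notin> ideal_pow R M (Suc e)" by blast
  \<comment> \<open>If \<open>a\<close> lies in \<open>M^(e+1)\<close>, then \<open>e = n\<close>
    and the value rises to \<open>n + 1\<close>; otherwise \<open>e\<close> is kept. Truncation
    assigns a value even to elements lying in every power.\<close>
  then show ?case by (cases "a \<in> ideal_pow R M (Suc e)") (auto intro: exI[of _ e] exI[of _ "Suc e"])
qed

text \<open>For \<open>e = n\<close> both elements vanish modulo \<open>M^n\<close> and
  \<open>u\<close> may be \<open>\<one>\<close>. For \<open>e < n\<close> the element
  \<open>s\<close> generates \<open>M^e\<close> modulo \<open>M^n\<close>, and a multiplier inside
  \<open>M\<close> would push \<open>a\<close> into \<open>M^(e+1)\<close>.\<close>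

lemma unit_multiplier_mod_power:
  assumes M: "maximalideal M R"
    and dim: "\<And>i. vectorspace.fin_dim (R Quot M) (ideal_layer R M i) \<and>
             vectorspace.dim (R Quot M) (ideal_layer R M i) = 1"
    and e: "e \<le> n" "a \<in> ideal_pow R M e" "e = n \<or> a \<notin> ideal_pow R M (Suc e)"
    and s: "s \<in> ideal_pow R M e" "s \<notin> ideal_pow R M (Suc e)"
  shows "\<exists>u\<in>carrier R. u \<notin> M \<and> a \<ominus> s \<otimes> u \<in> ideal_pow R M n"
proof -
  have MI: "ideal M R" by (rule maximalideal.axioms(1)[OF M])
  have PI: "ideal (ideal_pow R M j) R" for j by (rule ideal_pow_ideal[OF is_cring MI])
  have ac: "a \<in> carrier R" and sc: "s \<in> carrier R" using ideal.Icarr[OF PI] e(2) s(1) by auto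
  show ?thesis
  proof (cases "e = n")
    case True
    have "a \<ominus> s \<in> ideal_pow R M n"
      using True e(2) s(1) PI[of n] unfolding a_minus_def
      by (simp add: additive_subgroup.a_closed additive_subgroup.a_inv_closed ideal.axioms(1))
    then have "a \<ominus> s \<otimes> \<one> \<in> ideal_pow R M n" using sc by simp
    then show ?thesis using one_notin_maximalideal[OF M] by (intro bexI[of _ \<one>]) auto
  next
    case False
    then have an: "a \<notin> ideal_pow R M (Suc e)" and "Suc e \<le> n" using e by auto
    obtain r where r: "r \<in> carrier R" "a \<ominus> r \<otimes> s \<in> ideal_pow R M n"
      using one_dim_layers_generate[OF M dim s e(2)] by blast
    have "r \<notin> M"
    proof
      assume "r \<in> M"
      then have "s \<otimes> r \<in> ideal_pow R M (Suc e)"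
        unfolding ideal_pow_Suc by (rule ideal_prod.prod[OF s(1)])
      moreover have "a \<ominus> r \<otimes> s \<in> ideal_pow R M (Suc e)"
        using ideal_pow_antimono[OF MI \<open>Suc e \<le> n\<close>] r(2) by blast
      ultimately have "(a \<ominus> r \<otimes> s) \<oplus> s \<otimes> r \<in> ideal_pow R M (Suc e)"
        by (intro additive_subgroup.a_closed[OF ideal.axioms(1)[OF PI]])
      moreover have "(a \<ominus> r \<otimes> s) \<oplus> s \<otimes> r = a" using ac sc r(1) by algebra
      ultimately show False using an by simp
    qed
    then show ?thesis using r sc m_comm[of r s] by (intro bexI[of _ r]) auto
  qed
qed

text \<open>Exactness excludes \<open>s\<close> from the product of \<open>power_inter F e\<close>
  with \<open>M\<close>, which differs from \<open>power_inter F e\<close> only by one more power of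
  \<open>M\<close>. As \<open>s\<close> meets all the other conditions, it must fail the one at
  \<open>M\<close>.\<close>

lemma exact_element_of_power_inter:
  assumes F: "finite F" "F \<subseteq> maximal_ideals R" and M: "M \<in> F"
    and s: "s \<in> exact_elements R F (power_inter F e)"
  shows "s \<in> ideal_pow R M (e M)" "s \<notin> ideal_pow R M (Suc (e M))"
proof -
  have s1: "s \<in> power_inter F e" using s by (simp add: exact_elements_def)
  then show "s \<in> ideal_pow R M (e M)" using M by (simp add: power_inter_def)
  have MI: "ideal M R" by (rule ideal_maximal_ideals[OF F(2) M])
  have PI: "ideal (power_inter F e) R"
    by (rule ideal_ideal_monoid[OF F(2) power_inter_in_ideal_monoid[OF F]])
  have "M \<in> ideal_monoid R F"
    using ideal_monoid.mult[OF M ideal_monoid.unit, of R] ideal_prod_one[OF MI] by simp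
  moreover have "M \<noteq> carrier R"
    using F(2) M one_notin_maximalideal one_closed by (auto simp: maximal_ideals_def)
  ultimately have "s \<notin> power_inter F e \<cdot> M" using s by (auto simp: exact_elements_def)
  also have "power_inter F e \<cdot> M = power_inter F (e(M := Suc (e M)))"
    using ideal_prod_commute[OF PI MI] power_inter_mult[OF F M] by simp
  finally show "s \<notin> ideal_pow R M (Suc (e M))"
    using s1 by (auto simp: power_inter_def simp del: nat_pow_Suc split: if_splits)
qed

text \<open>The local multipliers are glued by the Chinese remainder theorem; each ideal of
  \<open>T\<close> adds a further congruence that keeps \<open>v\<close> out of it.\<close>

lemma unit_multiplier_avoiding:
  assumes F: "finite F" "F \<subseteq> maximal_ideals R" and T: "finite T" "T \<subseteq> maximal_ideals R"
    and c: "a \<in> carrier R" "s \<in> carrier R"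
    and local: "\<And>M. M \<in> F \<Longrightarrow> \<exists>u\<in>carrier R. u \<notin> M \<and> a \<ominus> s \<otimes> u \<in> ideal_pow R M (n M)"
  shows "\<exists>v\<in>carrier R. (\<forall>M\<in>F \<union> T. v \<notin> M) \<and> a \<ominus> s \<otimes> v \<in> power_inter F n"
proof -
  obtain u where u: "\<And>M. M \<in> F \<Longrightarrow> u M \<in> carrier R \<and> u M \<notin> M \<and> a \<ominus> s \<otimes> u M \<in> ideal_pow R M (n M)"
    using local by metis
  \<comment> \<open>Outside \<open>F\<close> any target not in \<open>M\<close> would serve, and
    \<open>\<one>\<close> lies in no maximal ideal.\<close>
  define t where "t M = (if M \<in> F then u M else \<one>)" for M
  have tc: "t M \<in> carrier R" for M using u by (simp add: t_def)
  have tM: "t M \<notin> M" if "M \<in> F \<union> T" for M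
    using that u T(2) one_notin_maximalideal by (auto simp: t_def maximal_ideals_def)
  \<comment> \<open>The exponent \<open>Suc (n M)\<close> forces a congruence modulo
    \<open>M\<close> itself even where \<open>n M = 0\<close>, so that \<open>v \<notin> M\<close>
    follows from \<open>t M \<notin> M\<close>.\<close>
  obtain v where v: "v \<in> carrier R" "\<And>M. M \<in> F \<union> T \<Longrightarrow> v \<ominus> t M \<in> ideal_pow R M (Suc (n M))"
    using maximal_power_approximation[of "F \<union> T" t "\<lambda>M. Suc (n M)"] F T tc by auto
  have "v \<notin> M" if M: "M \<in> F \<union> T" for M
  proof
    assume "v \<in> M"
    have MI: "ideal M R" using ideal_maximal_ideals[of "F \<union> T"] F T M by blast
    have "v \<ominus> t M \<in> M" using v(2)[OF M] ideal_pow_Suc_subset[OF MI] by blast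
    then have "v \<ominus> (v \<ominus> t M) \<in> M"
      using \<open>v \<in> M\<close> MI unfolding a_minus_def
      by (simp add: additive_subgroup.a_closed additive_subgroup.a_inv_closed ideal.axioms(1))
    moreover have "v \<ominus> (v \<ominus> t M) = t M" using v(1) tc[of M] by algebra
    ultimately show False using tM[OF M] by simp
  qed
  moreover have "a \<ominus> s \<otimes> v \<in> ideal_pow R M (n M)" if M: "M \<in> F" for M
  proof -
    have MI: "ideal M R" by (rule ideal_maximal_ideals[OF F(2) M])
    have PI: "ideal (ideal_pow R M (n M)) R" by (rule ideal_pow_ideal[OF is_cring MI])
    have "a \<ominus> s \<otimes> t M \<in> ideal_pow R M (n M)" using u[OF M] M by (simp add: t_def)
    moreover have "v \<ominus> t M \<in> ideal_pow R M (n M)"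
      using v(2)[of M] M ideal_pow_antimono[OF MI, of "n M" "Suc (n M)"] by auto
    ultimately have "(a \<ominus> s \<otimes> t M) \<oplus> (\<ominus> s) \<otimes> (v \<ominus> t M) \<in> ideal_pow R M (n M)"
      using PI c by (simp add: additive_subgroup.a_closed ideal.axioms(1) ideal.I_l_closed)
    moreover have "(a \<ominus> s \<otimes> t M) \<oplus> (\<ominus> s) \<otimes> (v \<ominus> t M) = a \<ominus> s \<otimes> v"
      using c v(1) tc[of M] by algebra
    ultimately show ?thesis by simp
  qed
  ultimately show ?thesis using v(1) c by (auto simp: power_inter_def)
qed

section \<open>Unital tuples and the relation \<open>proj_rel\<close>\<close>

lemma unital_tuples_iff:
  "a \<in> unital_tuples R k \<longleftrightarrow>
    a \<in> {..k} \<rightarrow>\<^sub>E carrier R \<and> (\<forall>M. maximalideal M R \<longrightarrow> (\<exists>i\<le>k. a i \<notin> M))"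
proof (cases "a \<in> {..k} \<rightarrow>\<^sub>E carrier R")
  case True
  then have "a ` {..k} \<subseteq> carrier R" by auto
  from genideal_eq_carrier_iff[OF this] True show ?thesis
    by (auto simp: unital_tuples_def image_subset_iff)
qed (simp add: unital_tuples_def)

text \<open>This is the colon ideal \<open>(I : d)\<close>. Transitivity of \<open>proj_rel\<close>
  rests on it: if it contains all entries of a unital tuple, then it contains \<open>\<one>\<close>,
  so \<open>d \<in> I\<close>.\<close>

lemma ideal_colon_element:
  assumes I: "ideal I R" and d: "d \<in> carrier R"
  shows "ideal {x \<in> carrier R. x \<otimes> d \<in> I} R"
proof -
  interpret I: ideal I R by (rule I)
  show ?thesis
  proof (rule idealI[OF ring_axioms])
    show "subgroup {x \<in> carrier R. x \<otimes> d \<in> I} (add_monoid R)"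
    proof (rule add.subgroupI, goal_cases)
      case 2 show ?case using d I.zero_closed zero_closed by (auto intro!: exI[of _ \<zero>])
    next case (3 x) then show ?case using d by (simp add: l_minus)
    next case (4 x y) then show ?case using d by (simp add: l_distr)
    qed auto
  next
    fix a x assume a: "a \<in> {x \<in> carrier R. x \<otimes> d \<in> I}" and x: "x \<in> carrier R"
    then have "x \<otimes> (a \<otimes> d) \<in> I" by (simp add: I.I_l_closed)
    then show "x \<otimes> a \<in> {x \<in> carrier R. x \<otimes> d \<in> I}" "a \<otimes> x \<in> {x \<in> carrier R. x \<otimes> d \<in> I}"
      using a x d by (simp_all add: m_assoc m_lcomm)
  qed
qed

lemma proj_rel_minors:
  assumes I: "ideal I R" and ab: "(a, b) \<in> proj_rel R I k" and ij: "i \<le> k" "j \<le> k"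
  shows "a i \<otimes> b j \<ominus> a j \<otimes> b i \<in> I"
proof -
  interpret I: ideal I R by (rule I)
  have c: "a l \<in> carrier R" "b l \<in> carrier R" if "l \<le> k" for l
    using ab that by (auto simp: proj_rel_def unital_tuples_def)
  have minor: "a l \<otimes> b m \<ominus> a m \<otimes> b l \<in> I" if "l < m" "m \<le> k" for l m
    using ab that by (simp add: proj_rel_def)
  consider "i < j" | "i = j" | "j < i" by linarith
  then show ?thesis
  proof cases
    case 1 then show ?thesis using minor ij by blast
  next
    case 2
    have "a i \<otimes> b i \<ominus> a i \<otimes> b i = \<zero>" using c ij by algebra
    then show ?thesis using 2 by simp
  next
    case 3
    have "a i \<otimes> b j \<ominus> a j \<otimes> b i = \<ominus> (a j \<otimes> b i \<ominus> a i \<otimes> b j)"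
      using c[OF ij(1)] c[OF ij(2)] by algebra
    then show ?thesis using minor[OF 3 ij(1)] by simp
  qed
qed

lemma equiv_proj_rel:
  assumes I: "ideal I R"
  shows "equiv (unital_tuples R k) (proj_rel R I k)"
proof (rule equivI)
  interpret I: ideal I R by (rule I)
  have c: "a l \<in> carrier R" if "a \<in> unital_tuples R k" "l \<le> k" for a l
    using that by (auto simp: unital_tuples_def)
  show "proj_rel R I k \<subseteq> unital_tuples R k \<times> unital_tuples R k" by (auto simp: proj_rel_def)
  show "refl_on (unital_tuples R k) (proj_rel R I k)"
  proof (rule refl_onI)
    fix a assume a: "a \<in> unital_tuples R k"
    have "a i \<otimes> a j \<ominus> a j \<otimes> a i \<in> I" if "i \<le> k" "j \<le> k" for i j
    proof -
      have "a i \<otimes> a j \<ominus> a j \<otimes> a i = \<zero>" using c[OF a that(1)] c[OF a that(2)] by algebra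
      then show ?thesis by simp
    qed
    then show "(a, a) \<in> proj_rel R I k" using a by (auto simp: proj_rel_def)
  qed
  show "sym (proj_rel R I k)"
  proof (rule symI)
    fix a b assume ab: "(a, b) \<in> proj_rel R I k"
    then have u: "a \<in> unital_tuples R k" "b \<in> unital_tuples R k" by (auto simp: proj_rel_def)
    have "b i \<otimes> a j \<ominus> b j \<otimes> a i \<in> I" if "i \<le> k" "j \<le> k" for i j
    proof -
      have "b i \<otimes> a j \<ominus> b j \<otimes> a i = a j \<otimes> b i \<ominus> a i \<otimes> b j"
        using c[OF u(1)] c[OF u(2)] that by (simp add: m_comm)
      then show ?thesis using proj_rel_minors[OF I ab that(2,1)] by simp
    qed
    then show "(b, a) \<in> proj_rel R I k" using u by (auto simp: proj_rel_def)
  qed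
  show "trans (proj_rel R I k)"
  proof (rule transI)
    fix a b e assume ab: "(a, b) \<in> proj_rel R I k" and be: "(b, e) \<in> proj_rel R I k"
    then have u: "a \<in> unital_tuples R k" "b \<in> unital_tuples R k" "e \<in> unital_tuples R k"
      by (auto simp: proj_rel_def)
    have "a i \<otimes> e j \<ominus> a j \<otimes> e i \<in> I" if ij: "i \<le> k" "j \<le> k" for i j
    proof -
      let ?d = "a i \<otimes> e j \<ominus> a j \<otimes> e i"
      let ?Q = "{x \<in> carrier R. x \<otimes> ?d \<in> I}"
      have d: "?d \<in> carrier R" using c u ij by simp
      have "b l \<in> ?Q" if l: "l \<le> k" for l
      proof -
        \<comment> \<open>The minor \<open>?d\<close> of \<open>a\<close> and \<open>e\<close>, once
          multiplied by an entry of the middle tuple \<open>b\<close>, becomes a combination of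
          minors of \<open>a\<close>, \<open>b\<close> and of \<open>b\<close>,
          \<open>e\<close>.\<close>
        have "b l \<otimes> ?d = (a i \<otimes> b l \<ominus> a l \<otimes> b i) \<otimes> e j \<oplus>
            (\<ominus> ((a j \<otimes> b l \<ominus> a l \<otimes> b j) \<otimes> e i) \<oplus> a l \<otimes> (b i \<otimes> e j \<ominus> b j \<otimes> e i))"
          using c[OF u(1)] c[OF u(2)] c[OF u(3)] ij l by algebra
        also have "\<dots> \<in> I"
          using proj_rel_minors[OF I ab] proj_rel_minors[OF I be] ij l c[OF u(1)] c[OF u(3)]
          by (intro I.a_closed I.a_inv_closed I.I_l_closed I.I_r_closed) auto
        finally show ?thesis using c[OF u(2) l] by simp
      qed
      then have "Idl (b ` {..k}) \<subseteq> ?Q"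
        by (intro genideal_minimal ideal_colon_element I d) auto
      then have "\<one> \<in> ?Q" using u(2) one_closed by (auto simp: unital_tuples_def)
      then show ?thesis using d by simp
    qed
    then show "(a, e) \<in> proj_rel R I k" using u by (auto simp: proj_rel_def)
  qed
qed

text \<open>Each minor is a combination of two of the differences \<open>a i \<ominus> b i\<close>.
  To represent a class it therefore suffices to approximate the given tuple entry by entry modulo
  \<open>I\<close>.\<close>

lemma proj_relI_congruent:
  assumes I: "ideal I R" and u: "a \<in> unital_tuples R k" "b \<in> unital_tuples R k"
    and cong: "\<And>i. i \<le> k \<Longrightarrow> a i \<ominus> b i \<in> I"
  shows "(a, b) \<in> proj_rel R I k"
proof -
  interpret I: ideal I R by (rule I)
  have c: "x l \<in> carrier R" if "x \<in> unital_tuples R k" "l \<le> k" for x l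
    using that by (auto simp: unital_tuples_def)
  have "a i \<otimes> b j \<ominus> a j \<otimes> b i \<in> I" if "i \<le> k" "j \<le> k" for i j
  proof -
    have "a i \<otimes> b j \<ominus> a j \<otimes> b i = (a i \<ominus> b i) \<otimes> b j \<oplus> \<ominus> ((a j \<ominus> b j) \<otimes> b i)"
      using c[OF u(1)] c[OF u(2)] that by algebra
    also have "\<dots> \<in> I"
      using cong that c[OF u(2)] by (intro I.a_closed I.a_inv_closed I.I_r_closed) auto
    finally show ?thesis .
  qed
  then show ?thesis using u by (auto simp: proj_rel_def)
qed

section \<open>Construction of the standard representative\<close>

lemma exists_standard_representative:
  assumes F: "finite F" "F \<subseteq> maximal_ideals R" "F \<noteq> {}"
    and I: "I \<in> ideal_monoid R F"
    and dim: "\<And>M i. M \<in> F \<Longrightarrow> vectorspace.fin_dim (R Quot M) (ideal_layer R M i) \<and>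
             vectorspace.dim (R Quot M) (ideal_layer R M i) = 1"
    and fin: "\<And>a. a \<in> carrier R \<Longrightarrow> a \<noteq> \<zero> \<Longrightarrow> finite {M. maximalideal M R \<and> a \<in> M}"
    and choice: "choice_conditions R F \<Sigma>"
    and nonzero: "\<And>J. J \<in> ideal_monoid R F \<Longrightarrow> \<Sigma> J \<noteq> \<zero>"
    and k: "1 \<le> k"
    and a: "a \<in> unital_tuples R k"
  shows "\<exists>J v. (\<forall>i\<in>{..k}. J i \<in> ideal_monoid R F \<and> I \<subseteq> J i) \<and>
      ideal_sum R J {..k} = carrier R \<and>
      ideal_sum R (\<lambda>i. PIdl (\<Sigma> (J i))) {..k} = carrier R \<and>
      (\<forall>i\<in>{..k}. v i \<in> carrier R - \<Union>F) \<and>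
      ideal_sum R (\<lambda>i. PIdl (\<Sigma> (J i) \<otimes> v i)) {..k} = carrier R \<and>
      (a, \<lambda>i\<in>{..k}. \<Sigma> (J i) \<otimes> v i) \<in> proj_rel R I k"
proof -
  have ac: "a i \<in> carrier R" if "i \<le> k" for i using a that by (auto simp: unital_tuples_def)
  obtain n where n: "I = power_inter F n" using ideal_monoid_eq_power_inter[OF F(1,2) I] by blast
  have "\<forall>i M. \<exists>e. i \<le> k \<longrightarrow> e \<le> n M \<and> a i \<in> ideal_pow R M e \<and> (e = n M \<or> a i \<notin> ideal_pow R M (Suc e))"
    using exists_truncated_valuation[OF ac] by blast
  then obtain e where e: "\<And>i M. i \<le> k \<Longrightarrow> e i M \<le> n M \<and> a i \<in> ideal_pow R M (e i M) \<and>
      (e i M = n M \<or> a i \<notin> ideal_pow R M (Suc (e i M)))" by metis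
  \<comment> \<open>For \<open>i > k\<close> the exponents \<open>e i\<close> are arbitrary, but
    \<open>J i\<close> is still in the monoid, so the facts about \<open>J i\<close> and
    \<open>s i\<close> up to \<open>s0\<close>, and \<open>JF\<close> in particular, hold for every
    \<open>i\<close>.\<close>
  define J where "J i = power_inter F (e i)" for i
  define s where "s i = \<Sigma> (J i)" for i
  have JF: "J i \<in> ideal_monoid R F" for i
    unfolding J_def by (rule power_inter_in_ideal_monoid[OF F(1,2)])
  have JI: "ideal (J i) R" for i by (rule ideal_ideal_monoid[OF F(2) JF])
  have s_exact: "s i \<in> exact_elements R F (J i)" for i
    using choice JF by (simp add: choice_conditions_def s_def)
  have sJ: "s i \<in> J i" for i using s_exact by (simp add: exact_elements_def)
  have sc: "s i \<in> carrier R" for i by (rule ideal.Icarr[OF JI sJ])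
  have s0: "s i \<noteq> \<zero>" for i using nonzero[OF JF] by (simp add: s_def)
  have IJ: "I \<subseteq> J i" if i: "i \<le> k" for i
  proof
    fix x assume "x \<in> I"
    then have x: "x \<in> carrier R" "\<And>M. M \<in> F \<Longrightarrow> x \<in> ideal_pow R M (n M)" by (auto simp: n power_inter_def)
    have "x \<in> ideal_pow R M (e i M)" if M: "M \<in> F" for M
      using ideal_pow_antimono[OF ideal_maximal_ideals[OF F(2) M], of "e i M" "n M"] e[OF i, of M] x(2)[OF M]
      by blast
    then show "x \<in> J i" using x(1) by (simp add: J_def power_inter_def)
  qed
  \<comment> \<open>With exponent zero at \<open>M\<close> the ideal \<open>J i\<close> is a product
    of ideals from \<open>F - {M}\<close>, and none of these products lies in
    \<open>M\<close>.\<close>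
  have e_pos: "e i M \<noteq> 0" if M: "M \<in> F" "J i \<subseteq> M" for i M
  proof
    assume "e i M = 0"
    then have "J i = power_inter (F - {M}) (e i)"
      using ideal_pow_0[of M] by (auto simp: J_def power_inter_def)
    then have "J i \<in> ideal_monoid R (F - {M})"
      using power_inter_in_ideal_monoid[of "F - {M}" "e i"] F by auto
    then have "M \<in> F - {M}"
      using ideal_monoid_subset_maximalideal[of "F - {M}" "J i" M] F(2) M by (auto simp: maximal_ideals_def)
    then show False by blast
  qed
  have Jsum: "ideal_sum R J {..k} = carrier R"
  proof (subst ideal_sum_eq_carrier_iff)
    show "\<forall>M. maximalideal M R \<longrightarrow> (\<exists>i\<in>{..k}. \<not> J i \<subseteq> M)"
    proof (intro allI impI)
      fix M assume M: "maximalideal M R"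
      obtain i where i: "i \<le> k" "a i \<notin> M" using a M by (auto simp: unital_tuples_iff)
      \<comment> \<open>If \<open>J i \<subseteq> M\<close>, then \<open>M\<close> belongs to
        \<open>F\<close> with positive exponent, which places \<open>a i\<close> in
        \<open>M\<close>.\<close>
      have "\<not> J i \<subseteq> M"
      proof
        assume sub: "J i \<subseteq> M"
        have MF: "M \<in> F" by (rule ideal_monoid_subset_maximalideal[OF F(2) JF M sub])
        then obtain m where "e i M = Suc m" using e_pos sub not0_implies_Suc by blast
        then have "a i \<in> M"
          using e[OF i(1), of M] ideal_pow_Suc_subset[OF maximalideal.axioms(1)[OF M], of m] by auto
        then show False using i(2) by simp
      qed
      then show "\<exists>i\<in>{..k}. \<not> J i \<subseteq> M" using i(1) by blast
    qed
  qed (use JI in auto)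
  \<comment> \<open>This is condition (4) on \<open>\<Sigma>\<close>.\<close>
  have ssum: "ideal_sum R (\<lambda>i. PIdl (s i)) {..k} = carrier R"
    using choice Jsum JF unfolding choice_conditions_def s_def by blast
  have s_unital: "\<exists>i\<le>k. s i \<notin> M" if "maximalideal M R" for M
    using ssum that sc by (subst (asm) principal_ideal_sum_eq_carrier_iff) auto
  have multiplier: "\<exists>v\<in>carrier R. (\<forall>M\<in>F \<union> T. v \<notin> M) \<and> a i \<ominus> s i \<otimes> v \<in> I"
    if i: "i \<le> k" and T: "finite T" "T \<subseteq> maximal_ideals R" for i T
    unfolding n
  proof (rule unit_multiplier_avoiding[OF F(1,2) T ac[OF i] sc])
    fix M assume M: "M \<in> F"
    have Mm: "maximalideal M R" using F(2) M by (auto simp: maximal_ideals_def)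
    have "s i \<in> ideal_pow R M (e i M)" "s i \<notin> ideal_pow R M (Suc (e i M))"
      using exact_element_of_power_inter[OF F(1,2) M] s_exact[of i] unfolding J_def by blast+
    then show "\<exists>u\<in>carrier R. u \<notin> M \<and> a i \<ominus> s i \<otimes> u \<in> ideal_pow R M (n M)"
      using unit_multiplier_mod_power[OF Mm dim[OF M], of "e i M" "n M" "a i" "s i"] e[OF i, of M] by blast
  qed
  let ?D = "\<lambda>x. {M. maximalideal M R \<and> x \<in> M}"
  have D: "finite (?D x)" "?D x \<subseteq> maximal_ideals R" if "x \<in> carrier R" "x \<noteq> \<zero>" for x
    using fin that by (auto simp: maximal_ideals_def)
  \<comment> \<open>Index \<open>1\<close> exists because \<open>1 \<le> k\<close>, and
    \<open>?D (s 1)\<close> is finite because \<open>\<Sigma>\<close> is nowhere zero.\<close>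
  obtain v0 where v0: "v0 \<in> carrier R" "\<And>M. M \<in> F \<union> ?D (s 1) \<Longrightarrow> v0 \<notin> M" "a 0 \<ominus> s 0 \<otimes> v0 \<in> I"
    using multiplier[of 0 "?D (s 1)"] D[OF sc s0, of 1] by auto
  \<comment> \<open>Avoiding a single ideal of \<open>F\<close> already makes \<open>v0\<close>
    nonzero, so only finitely many maximal ideals contain it.\<close>
  obtain M0 where M0: "M0 \<in> F" using F(3) by blast
  have "\<zero> \<in> M0"
    using additive_subgroup.zero_closed[OF ideal.axioms(1)[OF ideal_maximal_ideals[OF F(2) M0]]] .
  then have v00: "v0 \<noteq> \<zero>" using v0(2)[of M0] M0 by auto
  \<comment> \<open>By primality these are exactly the maximal ideals containing
    \<open>s 0 \<otimes> v0\<close>.\<close>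
  let ?T = "?D (s 0) \<union> ?D v0"
  have T: "finite ?T" "?T \<subseteq> maximal_ideals R" using D[OF sc s0, of 0] D[OF v0(1) v00] by auto
  have "\<forall>i\<in>{..k}. \<exists>x. x \<in> carrier R \<and> (\<forall>M\<in>F \<union> ?T. x \<notin> M) \<and> a i \<ominus> s i \<otimes> x \<in> I"
    using multiplier[OF _ T] by (simp add: Bex_def)
  from bchoice[OF this] obtain w where
    "\<forall>i\<in>{..k}. w i \<in> carrier R \<and> (\<forall>M\<in>F \<union> ?T. w i \<notin> M) \<and> a i \<ominus> s i \<otimes> w i \<in> I" ..
  then have w: "w i \<in> carrier R \<and> (\<forall>M\<in>F \<union> ?T. w i \<notin> M) \<and> a i \<ominus> s i \<otimes> w i \<in> I" if "i \<le> k" for i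
    using that by simp
  define v where "v i = (if i = 0 then v0 else w i)" for i
  have vc: "v i \<in> carrier R" and vF: "\<And>M. M \<in> F \<Longrightarrow> v i \<notin> M" and vI: "a i \<ominus> s i \<otimes> v i \<in> I"
    if "i \<le> k" for i
    using w[OF that] v0 by (auto simp: v_def)
  have sv_unital: "\<exists>i\<le>k. s i \<otimes> v i \<notin> M" if M: "maximalideal M R" for M
  proof (rule ccontr)
    assume "\<not> ?thesis"
    then have sv: "s i \<in> M \<or> v i \<in> M" if "i \<le> k" for i
      using primeideal.I_prime[OF maximalideal_prime[OF M] sc vc] that by blast
    have "s i \<in> M" if i: "i \<le> k" for i
    proof (cases "M \<in> F")
      case True
      then show ?thesis using sv vF i by blast
    next
      case False
      \<comment> \<open>Since \<open>s 0 \<otimes> v 0\<close> lies in \<open>M\<close>, the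
        \<open>v j\<close> with \<open>j \<ge> 1\<close> avoid \<open>M\<close>, so these
        \<open>s j\<close> lie in \<open>M\<close>. From \<open>s 1 \<in> M\<close> follows
        \<open>v 0 \<notin> M\<close>, and this leaves \<open>s 0 \<in> M\<close>.\<close>
      have MT: "M \<in> ?T" using sv[of 0] M by (auto simp: v_def)
      have s1: "s j \<in> M" if "j \<le> k" "j \<noteq> 0" for j
        using sv[OF that(1)] w[OF that(1)] MT that(2) by (auto simp: v_def)
      then have "v 0 \<notin> M" using v0(2)[of M] M k by (simp add: v_def)
      then show ?thesis using s1[OF i] sv[of 0] by (cases "i = 0") auto
    qed
    then show False using s_unital[OF M] by blast
  qed
  have svsum: "ideal_sum R (\<lambda>i. PIdl (s i \<otimes> v i)) {..k} = carrier R"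
  proof (subst principal_ideal_sum_eq_carrier_iff)
    show "\<forall>M. maximalideal M R \<longrightarrow> (\<exists>i\<in>{..k}. s i \<otimes> v i \<notin> M)"
      using sv_unital by (simp add: Bex_def)
  qed (use sc vc in auto)
  let ?b = "\<lambda>i\<in>{..k}. s i \<otimes> v i"
  have "?b \<in> {..k} \<rightarrow>\<^sub>E carrier R" using sc vc by auto
  moreover have "\<exists>i\<le>k. ?b i \<notin> M" if M: "maximalideal M R" for M
  proof -
    obtain i where "i \<le> k" "s i \<otimes> v i \<notin> M" using sv_unital[OF M] by blast
    then show ?thesis by (intro exI[of _ i]) simp
  qed
  ultimately have b: "?b \<in> unital_tuples R k" by (simp only: unital_tuples_iff) blast
  have "(a, ?b) \<in> proj_rel R I k"
    using vI by (intro proj_relI_congruent a b ideal_ideal_monoid[OF F(2) I]) simp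
  then show ?thesis
    using JF IJ Jsum ssum vc vF svsum unfolding s_def
    by (intro exI[of _ J] exI[of _ v]) auto
qed

end

section \<open>Passage from representatives to classes, with the degenerate cases\<close>

theorem mainTheorem11:
  fixes R :: "('a, 'b) ring_scheme"
    and I :: "'a set" and F :: "'a set set"
    and \<Sigma> :: "'a set \<Rightarrow> 'a" and k :: nat
  assumes "dedekind_type_domain R"
    and "I \<in> ideal_monoid R (maximal_ideals R)"
    and "k \<ge> 2"
    and "finite F" and "F \<subseteq> maximal_ideals R"
    and "\<And>M. M \<in> maximal_ideals R \<Longrightarrow> I \<subseteq> M \<Longrightarrow> M \<in> F"
    and "\<Sigma> \<in> ideal_monoid R F \<rightarrow> carrier R"
    and "\<And>J. J \<in> ideal_monoid R F \<Longrightarrow> \<Sigma> J \<noteq> \<zero>\<^bsub>R\<^esub>"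
    and "choice_conditions R F \<Sigma>"
  shows "proj_space R I k =
    {proj_class R I k (\<lambda>i\<in>{..k}. \<Sigma> (J i) \<otimes>\<^bsub>R\<^esub> v i) | J v.
      (\<forall>i\<in>{..k}. J i \<in> ideal_monoid R F \<and> I \<subseteq> J i) \<and>
      ideal_sum R J {..k} = carrier R \<and>
      ideal_sum R (\<lambda>i. PIdl\<^bsub>R\<^esub> (\<Sigma> (J i))) {..k} = carrier R \<and>
      (\<forall>i\<in>{..k}. v i \<in> carrier R - \<Union>F) \<and>
      ideal_sum R (\<lambda>i. PIdl\<^bsub>R\<^esub> (\<Sigma> (J i) \<otimes>\<^bsub>R\<^esub> v i)) {..k} = carrier R}"
    (is "_ = {_ | J v. ?good J v}")
proof -
  interpret cring R using assms(1) by (simp add: dedekind_type_domain_def)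
  let ?b = "\<lambda>J v. \<lambda>i\<in>{..k}. \<Sigma> (J i) \<otimes>\<^bsub>R\<^esub> v i"
  have IF: "I \<in> ideal_monoid R F"
    by (rule ideal_monoid_restrict[OF order_refl assms(2)]) (use assms(6) in blast)
  have I: "ideal I R" by (rule ideal_ideal_monoid[OF assms(5) IF])
  have eqv: "equiv (unital_tuples R k) (proj_rel R I k)" by (rule equiv_proj_rel[OF I])
  \<comment> \<open>This yields the inclusion from right to left: the last condition of
    \<open>?good\<close> says that the tuple is unital.\<close>
  have good_unital: "?b J v \<in> unital_tuples R k" if g: "?good J v" for J v
  proof -
    have c: "\<Sigma> (J i) \<otimes>\<^bsub>R\<^esub> v i \<in> carrier R" if "i \<le> k" for i
      using g assms(7) that by (intro m_closed) auto
    have "\<forall>M. maximalideal M R \<longrightarrow> (\<exists>i\<in>{..k}. \<Sigma> (J i) \<otimes>\<^bsub>R\<^esub> v i \<notin> M)"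
      using g c by (subst principal_ideal_sum_eq_carrier_iff[symmetric]) auto
    then show ?thesis using c by (auto simp: unital_tuples_iff)
  qed
  have representative: "\<exists>J v. ?good J v \<and> (a, ?b J v) \<in> proj_rel R I k"
    if a: "a \<in> unital_tuples R k" for a
  proof (cases "F = {}")
    case True
    \<comment> \<open>The empty \<open>F\<close> generates only the unit ideal, so \<open>I\<close>
      is the whole ring, all unital tuples are equivalent, and the tuple with all entries
      \<open>\<one>\<close> represents their class.\<close>
    have I_carr: "I = carrier R"
      using IF unfolding True by (cases rule: ideal_monoid.cases) auto
    have \<Sigma>1: "\<Sigma> (carrier R) = \<one>\<^bsub>R\<^esub>" using assms(9) by (simp add: choice_conditions_def)
    let ?J = "\<lambda>_::nat. carrier R" and ?v = "\<lambda>_::nat. \<one>\<^bsub>R\<^esub>"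
    have not_sub: "\<not> carrier R \<subseteq> M" if "maximalideal M R" for M
      using one_notin_maximalideal[OF that] one_closed by blast
    have g: "?good ?J ?v"
      using I_carr \<Sigma>1 True ideal_monoid.unit[of R F] one_notin_maximalideal not_sub
      by (auto simp: ideal_sum_eq_carrier_iff principal_ideal_sum_eq_carrier_iff oneideal)
    have b: "?b ?J ?v \<in> unital_tuples R k" by (rule good_unital[OF g])
    have c: "x i \<in> carrier R" if "x \<in> unital_tuples R k" "i \<le> k" for x i
      using that by (auto simp: unital_tuples_def)
    have "(a, ?b ?J ?v) \<in> proj_rel R I k"
      by (rule proj_relI_congruent[OF I a b])
        (use c[OF a] c[OF b] in \<open>unfold I_carr, intro minus_closed\<close>)
    from conjI[OF g this] show ?thesis by (rule exI[of _ ?J, OF exI[of _ ?v]])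
  next
    case False
    \<comment> \<open>In a field the only maximal ideal is zero; if it belonged to \<open>F\<close>,
      then \<open>\<Sigma> M \<in> M\<close> would force \<open>\<Sigma> M\<close> to vanish. Hence
      the conditions on maximal ideals and on finiteness are available.\<close>
    have "\<not> field R"
    proof
      assume "field R"
      then interpret field R .
      obtain M where M: "M \<in> F" using False by blast
      then have Mm: "maximalideal M R" using assms(5) by (auto simp: maximal_ideals_def)
      have MI: "ideal M R" by (rule maximalideal.axioms(1)[OF Mm])
      then have "M = {\<zero>\<^bsub>R\<^esub>}" using all_ideals maximalideal.I_notcarr[OF Mm] by blast
      moreover have MF: "M \<in> ideal_monoid R F"
        using ideal_monoid.mult[OF M ideal_monoid.unit, of R] ideal_prod_one[OF MI] by simp
      ultimately have "\<Sigma> M = \<zero>\<^bsub>R\<^esub>"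
        using assms(9) by (auto simp: choice_conditions_def exact_elements_def)
      then show False using assms(8)[OF MF] by simp
    qed
    then have dim: "\<And>M i. maximalideal M R \<Longrightarrow> vectorspace.fin_dim (R Quot M) (ideal_layer R M i) \<and>
             vectorspace.dim (R Quot M) (ideal_layer R M i) = 1"
      and fin: "\<And>a. a \<in> carrier R - {\<zero>\<^bsub>R\<^esub>} \<Longrightarrow> finite {M. maximalideal M R \<and> a \<in> M}"
      using assms(1) unfolding dedekind_type_domain_def by blast+
    have "\<exists>J v. (\<forall>i\<in>{..k}. J i \<in> ideal_monoid R F \<and> I \<subseteq> J i) \<and>
      ideal_sum R J {..k} = carrier R \<and>
      ideal_sum R (\<lambda>i. PIdl\<^bsub>R\<^esub> (\<Sigma> (J i))) {..k} = carrier R \<and>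
      (\<forall>i\<in>{..k}. v i \<in> carrier R - \<Union>F) \<and>
      ideal_sum R (\<lambda>i. PIdl\<^bsub>R\<^esub> (\<Sigma> (J i) \<otimes>\<^bsub>R\<^esub> v i)) {..k} = carrier R \<and>
      (a, ?b J v) \<in> proj_rel R I k"
    proof (rule exists_standard_representative[OF assms(4,5) False IF _ _ assms(9,8) _ a])
      show "1 \<le> k" using assms(3) by simp
    qed (use dim fin assms(5) in \<open>auto simp: maximal_ideals_def\<close>)
    then show ?thesis by blast
  qed
  show ?thesis
  proof (intro subset_antisym subsetI)
    fix Y assume "Y \<in> proj_space R I k"
    then obtain a where a: "a \<in> unital_tuples R k" "Y = proj_rel R I k `` {a}"
      unfolding proj_space_def by (rule quotientE)
    obtain J v where Jv: "?good J v" "(a, ?b J v) \<in> proj_rel R I k"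
      using representative[OF a(1)] by blast
    have "Y = proj_class R I k (?b J v)"
      unfolding a(2) proj_class_def by (rule equiv_class_eq[OF eqv Jv(2)])
    then show "Y \<in> {proj_class R I k (?b J v) | J v. ?good J v}" using Jv(1) by blast
  next
    fix Y assume "Y \<in> {proj_class R I k (?b J v) | J v. ?good J v}"
    then obtain J v where Jv: "?good J v" "Y = proj_class R I k (?b J v)" by blast
    show "Y \<in> proj_space R I k"
      unfolding proj_space_def Jv(2) proj_class_def by (rule quotientI[OF good_unital[OF Jv(1)]])
  qed
qed

end
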